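(* Let $\Sigma$ be an alphabet, let $F:\Sigma^{\mathbb{Z}}\to\Sigma^{\mathbb{Z}}$ be a rapidly left expansive cellular automaton, and let $x\in\mathcal{N}(\Sigma)$ be a number-like configuration. Then $\operatorname{frac}(F^t(x))=\operatorname{frac}(x)$ holds for only finitely many $t\in\mathbb{N}$.
   Context: $\mathbb{N}=\{0,1,2,\dots\}$ and $\mathbb{Z}_+=\{1,2,\dots\}$. An alphabet is a finite set $\Sigma=\{0,1,\dots,n-1\}$ with $n\in\mathbb{Z}_+$. Elements of $\Sigma^{\mathbb{Z}}$ are called configurations; $x[i]$ is the value of $x$ at $i$; $0^{\mathbb{Z}}$ is the all-zero configuration. For $x\in\Sigma^{\mathbb{Z}}$, $\operatorname{frac}(x)\in\Sigma^{\mathbb{N}}$ is defined by $\operatorname{frac}(x)[i]=x[i]$ for $i\in\mathbb{N}$. A map $F:\Sigma^{\mathbb{Z}}\to\Sigma^{\mathbb{Z}}$ is a cellular automaton (CA) if there are $m,n\in\mathbb{N}$ and $f:\Sigma^{m+n+1}\to\Sigma$ with $F(x)[i]=f(x[i-m],\dots,x[i],\dots,x[i+n])$ for all $x\in\Sigma^{\mathbb{Z}}$, $i\in\mathbb{Z}$. A configuration $x\neq 0^{\mathbb{Z}}$ is number-like if there is $N\in\mathbb{Z}$ with $x[i]=0$ for all $i<N$; its left edge $\ell(x)$ is the least $N\in\mathbb{Z}$ with $x[N]\neq 0$. $\mathcal{N}(\Sigma)$ is the set of number-like configurations over $\Sigma$. The space-time diagram of $x\in\Sigma^{\mathbb{Z}}$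 with respect to $F$ is $\theta\in\Sigma^{\mathbb{Z}\times(-\mathbb{N})}$, $\theta[(i,j)]=F^{-j}(x)[i]$ for $i\in\mathbb{Z}$, $j\le 0$. For $h,d\in\mathbb{N}$, $w\in\mathbb{Z}_+$ let $R(h,d,w)=\{(i,j)\in\mathbb{Z}^2\mid 0\le i<w,\ -d\le j\le h\}$. $F$ is left expansive with dimensions $(h,d,w)$ if, with $R=R(h,d,w)$, for all space-time diagrams $\theta_1,\theta_2$ with respect to $F$ and all $(i_1,j_1),(i_2,j_2)\in\mathbb{Z}^2$ with $(i_1,j_1)+R,\ (i_2,j_2)+R\subseteq\mathbb{Z}\times(-\mathbb{N})$: if $\theta_1[(i_1,j_1)+\rho]=\theta_2[(i_2,j_2)+\rho]$ for all $\rho\in R$, then $\theta_1[(i_1-1,j_1)]=\theta_2[(i_2-1,j_2)]$. $F$ is left spreading if $F(0^{\mathbb{Z}})=0^{\mathbb{Z}}$ and for each $x\in\mathcal{N}(\Sigma)$ there is $t\in\mathbb{Z}_+$ such that $\ell(F^t(x))<\ell(x)$ (in particular $F^t(x)\neq 0^{\mathbb{Z}}$). The spreading speed of a left spreading $F$ is $\sup_{x\in\mathcal{N}(\Sigma)}\limsup_{t\to\infty}\frac{-\ell(F^t(x))}{t}$. $F$ is rapidly left expansive if there are $h,d\in\mathbb{N}$ and $w\in\mathbb{Z}_+$ such that $F$ is left expansive with dimensions $(h,d,w)$, $F$ is left spreading with spreading speed $s$, and $s<1/h$ (with the convention $1/0=\infty$). *)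

theory Defs
  imports Complex_Main "HOL-Library.Extended_Real" "HOL-Library.Liminf_Limsup"
    "HOL-Library.Product_Plus"
begin

text \<open>The alphabet is \<open>{..<n}\<close>. Configurations are functions \<^typ>\<open>int \<Rightarrow> nat\<close> with values in
  the alphabet, and a map on configurations is a total function on \<^typ>\<open>int \<Rightarrow> nat\<close> of which only
  the restriction to \<open>configs n\<close> is ever considered.\<close>

definition configs :: "nat \<Rightarrow> (int \<Rightarrow> nat) set" where
  "configs n = {x. \<forall>i. x i < n}"

definition zero_config :: "int \<Rightarrow> nat" where
  "zero_config = (\<lambda>_. 0)"

definition frac_part :: "(int \<Rightarrow> nat) \<Rightarrow> (nat \<Rightarrow> nat)" where
  "frac_part x = (\<lambda>i. x (int i))"

text \<open>The words of length \<open>a + b + 1\<close> over the alphabet are lists, so the local rule is applied to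
  the list \<open>[x (i - a), \<dots>, x i, \<dots>, x (i + b)]\<close>.\<close>

definition cellular_automaton :: "nat \<Rightarrow> ((int \<Rightarrow> nat) \<Rightarrow> (int \<Rightarrow> nat)) \<Rightarrow> bool" where
  "cellular_automaton n F \<longleftrightarrow>
     (\<exists>(a::nat) (b::nat) (f :: nat list \<Rightarrow> nat).
        (\<forall>u. length u = a + b + 1 \<and> set u \<subseteq> {..<n} \<longrightarrow> f u < n) \<and>
        (\<forall>x\<in>configs n. \<forall>i. F x i = f (map x [i - int a..i + int b])))"

definition number_like :: "nat \<Rightarrow> (int \<Rightarrow> nat) set" where
  "number_like n = {x \<in> configs n. x \<noteq> zero_config \<and> (\<exists>N. \<forall>i<N. x i = 0)}"

text \<open>Only meaningful on number-like configurations, where the least element exists.\<close>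

definition left_edge :: "(int \<Rightarrow> nat) \<Rightarrow> int" where
  "left_edge x = (LEAST N. x N \<noteq> 0)"

text \<open>Diagrams live on \<open>UNIV \<times> {..0}\<close>; the values at points with positive second coordinate are
  junk and are never used below.\<close>

definition space_time :: "((int \<Rightarrow> nat) \<Rightarrow> (int \<Rightarrow> nat)) \<Rightarrow> (int \<Rightarrow> nat) \<Rightarrow> (int \<times> int \<Rightarrow> nat)" where
  "space_time F x = (\<lambda>(i, j). (F ^^ nat (- j)) x i)"

definition space_time_diagrams :: "nat \<Rightarrow> ((int \<Rightarrow> nat) \<Rightarrow> (int \<Rightarrow> nat)) \<Rightarrow> (int \<times> int \<Rightarrow> nat) set" where
  "space_time_diagrams n F = space_time F ` configs n"

definition rect :: "nat \<Rightarrow> nat \<Rightarrow> nat \<Rightarrow> (int \<times> int) set" where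
  "rect h d w = {(i, j). 0 \<le> i \<and> i < int w \<and> - int d \<le> j \<and> j \<le> int h}"

definition left_expansive ::
    "nat \<Rightarrow> ((int \<Rightarrow> nat) \<Rightarrow> (int \<Rightarrow> nat)) \<Rightarrow> nat \<Rightarrow> nat \<Rightarrow> nat \<Rightarrow> bool" where
  "left_expansive n F h d w \<longleftrightarrow>
     (\<forall>\<theta>\<^sub>1\<in>space_time_diagrams n F. \<forall>\<theta>\<^sub>2\<in>space_time_diagrams n F. \<forall>i\<^sub>1 j\<^sub>1 i\<^sub>2 j\<^sub>2.
        (+) (i\<^sub>1, j\<^sub>1) ` rect h d w \<subseteq> UNIV \<times> {..0} \<longrightarrow>
        (+) (i\<^sub>2, j\<^sub>2) ` rect h d w \<subseteq> UNIV \<times> {..0} \<longrightarrow>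
        (\<forall>\<rho>\<in>rect h d w. \<theta>\<^sub>1 ((i\<^sub>1, j\<^sub>1) + \<rho>) = \<theta>\<^sub>2 ((i\<^sub>2, j\<^sub>2) + \<rho>)) \<longrightarrow>
        \<theta>\<^sub>1 (i\<^sub>1 - 1, j\<^sub>1) = \<theta>\<^sub>2 (i\<^sub>2 - 1, j\<^sub>2))"

definition left_spreading :: "nat \<Rightarrow> ((int \<Rightarrow> nat) \<Rightarrow> (int \<Rightarrow> nat)) \<Rightarrow> bool" where
  "left_spreading n F \<longleftrightarrow>
     F zero_config = zero_config \<and>
     (\<forall>x\<in>number_like n. \<exists>t\<ge>1. (F ^^ t) x \<in> number_like n \<and> left_edge ((F ^^ t) x) < left_edge x)"

text \<open>The supremum and the upper limit are taken in the extended reals. For a left spreading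
  cellular automaton all iterates of a number-like configuration are number-like, so
  \<^const>\<open>left_edge\<close> is applied only where it is meaningful; the term for \<open>t = 0\<close> does not affect the
  upper limit.\<close>

definition spreading_speed :: "nat \<Rightarrow> ((int \<Rightarrow> nat) \<Rightarrow> (int \<Rightarrow> nat)) \<Rightarrow> ereal" where
  "spreading_speed n F =
     (SUP x\<in>number_like n. limsup (\<lambda>t. ereal (- real_of_int (left_edge ((F ^^ t) x)) / real t)))"

definition rapidly_left_expansive :: "nat \<Rightarrow> ((int \<Rightarrow> nat) \<Rightarrow> (int \<Rightarrow> nat)) \<Rightarrow> bool" where
  "rapidly_left_expansive n F \<longleftrightarrow>
     (\<exists>h d w. w \<ge> 1 \<and> left_expansive n F h d w \<and> left_spreading n F \<and>
        spreading_speed n F < (if h = 0 then \<infinity> else ereal (1 / real h)))"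

end

theory Submission
  imports Defs "HOL-Library.FuncSet" "HOL-Library.Infinite_Set"
begin

text \<open>Suppose that the fractional part of \<open>x\<close> recurs at infinitely many times. The contradiction
  comes from following, through time, how far to the left \<open>F\<^sup>t(x)\<close> is spatially periodic.

  A single recurrence at a time \<open>p > 0\<close> makes the orbit of \<open>x\<close> periodic in time with period \<open>p\<close>
  far to the right, for as many steps as one likes. There the columns of the space-time diagram take
  finitely many values, and left expansivity makes each column a function of its right neighbour.
  A sequence of states that extends infinitely to the right and is deterministic towards the left is
  periodic (\<open>backward_deterministic_imp_periodic\<close>), so \<open>x\<close> has a spatial period \<open>q\<close> on some half-line
  (\<open>recurrence_imp_right_periodic\<close>).

  Now let \<open>b t\<close> be the leftmost position from which \<open>F\<^sup>t(x)\<close> is \<open>q\<close>-periodic. It exists, since a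
  number-like configuration is not periodic on the whole line. It moves right by at most the left
  radius of \<open>F\<close> in one step, and left expansivity, applied to the diagram and its translate by \<open>q\<close>,
  yields a maximum principle: for \<open>t \<ge> h\<close>, \<open>b t\<close> is never the maximum of \<open>b\<close> over \<open>{t - h..t + d}\<close>.
  If \<open>b\<close> were unbounded, it would hence set new records at least every \<open>d\<close> steps and, moving right
  only slowly, could not come back to a small value; but \<open>b\<close> is small at each recurrence. So \<open>b\<close> is
  bounded, and then the maximum principle pushes it to the left at speed at least \<open>1/h\<close>
  (\<open>recurrent_boundary_drifts_left\<close>). This is faster than the spreading speed, so \<open>b\<close> eventually
  lies at least \<open>q\<close> to the left of the left edge of \<open>F\<^sup>t(x)\<close>. There \<open>F\<^sup>t(x)\<close> is zero, and periodicity
  gives the value zero at the left edge itself, which is absurd.\<close>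

section \<open>Two combinatorial facts on sequences\<close>

text \<open>Some value \<open>v\<close> occurs infinitely often. If \<open>q\<close> is the distance of two of its occurrences, then
  going \<open>q\<close> places to the left from any occurrence of \<open>v\<close> leads to \<open>v\<close> again. So the sequence and its
  translate by \<open>q\<close> agree at arbitrarily distant places, and hence everywhere to the left of them.\<close>

lemma backward_deterministic_imp_periodic:
  fixes s :: "nat \<Rightarrow> 'a"
  assumes fin: "finite (range s)"
    and det: "\<And>i j. s (Suc i) = s (Suc j) \<Longrightarrow> s i = s j"
  shows "\<exists>q>0. \<forall>i. s (i + q) = s i"
proof -
  have leftwards: "s i = s j" if "s (i + k) = s (j + k)" for i j k
    using that by (induction k) (auto dest: det)
  obtain v where inf: "infinite {i. s i = v}"
    using pigeonhole_infinite[of UNIV s] fin by auto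
  obtain i0 where i0: "s i0 = v"
    using inf by (metis (mono_tags) finite.emptyI mem_Collect_eq equals0I)
  obtain i1 where i1: "i1 > i0" "s i1 = v"
    using inf by (auto simp: infinite_nat_iff_unbounded)
  define q where "q = i1 - i0"
  have "s (i + q) = s i" for i
  proof -
    obtain m where m: "m > i + q" "s m = v"
      using inf by (auto simp: infinite_nat_iff_unbounded)
    have "s ((m - q) + q) = s (i0 + q)" using m i0 i1 by (simp add: q_def)
    then have "s (m - q) = s i0" by (rule leftwards)
    then have "s ((i + q) + (m - q - i)) = s (i + (m - q - i))" using m i0 by simp
    then show ?thesis by (rule leftwards)
  qed
  moreover have "q > 0" using i1 by (simp add: q_def)
  ultimately show ?thesis by blast
qed

text \<open>Recurrence to \<open>I\<close> bounds \<open>b\<close> above, because an unbounded \<open>b\<close> would set a record every \<open>d\<close>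
  steps. The maximum principle then applies to the bound itself: if \<open>b\<close> stays at most \<open>C\<close> from some
  time on, it stays at most \<open>C - 1\<close> from \<open>h\<close> steps later on.\<close>

lemma recurrent_boundary_drifts_left:
  fixes b :: "nat \<Rightarrow> int"
  assumes slow: "\<And>t. b (Suc t) \<le> b t + int a"
    and maxpr: "\<And>t. t \<ge> h \<Longrightarrow> \<exists>\<tau>\<in>{t - h..t + d}. b t < b \<tau>"
    and rec: "infinite {t. b t \<le> I}"
  shows "\<exists>B. \<forall>m t. h * m \<le> t \<longrightarrow> b t \<le> B - int m"
proof -
  have slow': "b (t + k) \<le> b t + int a * int k" for t k
  proof (induction k)
    case (Suc k)
    then show ?case using slow[of "t + k"] by (simp add: algebra_simps)
  qed simp
  have "\<exists>B. \<forall>t. b t \<le> B"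
  proof (rule ccontr)
    assume unb: "\<nexists>B. \<forall>t. b t \<le> B"
    \<comment> \<open>Once \<open>b\<close> has exceeded \<open>M\<close>, its maximum so far is at a time beyond \<open>h\<close>, where the maximum
      principle applies, so a value above \<open>M\<close> follows within \<open>d\<close> steps; and a value at most \<open>I\<close> could
      not rise above \<open>M\<close> that fast.\<close>
    define M where "M = max (Max (b ` {..h})) (I + int a * int d)"
    obtain t0 where t0: "b t0 > M" using unb by (meson not_le_imp_less)
    have high: "b t > I" if "t \<ge> t0" for t
    proof -
      obtain u where u: "u \<le> t" "\<And>v. v \<le> t \<Longrightarrow> b v \<le> b u"
      proof -
        have "Max (b ` {..t}) \<in> b ` {..t}" by (rule Max_in) auto
        then obtain u where "u \<le> t" "b u = Max (b ` {..t})" by (metis atMost_iff imageE)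
        then show ?thesis using that by (metis Max_ge atMost_iff finite_atMost finite_imageI imageI)
      qed
      have uM: "b u > M" using u(2)[OF that] t0 by simp
      have "u \<ge> h"
      proof (rule ccontr)
        assume "\<not> u \<ge> h"
        then have "b u \<le> Max (b ` {..h})" by (intro Max_ge) auto
        then show False using uM unfolding M_def by linarith
      qed
      then obtain \<tau> where \<tau>: "\<tau> \<le> u + d" "b u < b \<tau>" using maxpr by fastforce
      have "\<tau> > t" using u(2)[of \<tau>] \<tau>(2) by linarith
      have "b \<tau> \<le> b t + int a * int (\<tau> - t)" using slow'[of t "\<tau> - t"] \<open>\<tau> > t\<close> by simp
      also have "\<dots> \<le> b t + int a * int d"
        using \<tau>(1) u(1) by (intro add_left_mono mult_left_mono) auto
      finally show ?thesis using uM \<tau>(2) by (simp add: M_def)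
    qed
    obtain t where "t > t0" "b t \<le> I" using rec by (auto simp: infinite_nat_iff_unbounded)
    then show False using high[of t] by simp
  qed
  then obtain B where B: "\<And>t. b t \<le> B" by blast
  have "h * m \<le> t \<longrightarrow> b t \<le> B - int m" for m t
  proof (induction m arbitrary: t)
    case 0
    then show ?case using B by simp
  next
    case (Suc m)
    show ?case
    proof
      assume t: "h * Suc m \<le> t"
      then have "h \<le> t" by simp
      then obtain \<tau> where "t - h \<le> \<tau>" "b t < b \<tau>" using maxpr by fastforce
      moreover have "h * m \<le> \<tau>" using t \<open>t - h \<le> \<tau>\<close> by simp
      ultimately show "b t \<le> B - int (Suc m)" using Suc.IH[of \<tau>] by simp
    qed
  qed
  then show ?thesis by blast
qed

section \<open>Orbits of number-like configurations\<close>

lemma cellular_automaton_local: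
  assumes "cellular_automaton n F"
  shows "\<exists>a b. \<forall>y\<in>configs n. \<forall>z\<in>configs n. \<forall>i j.
    (\<forall>k\<in>{- int a..int b}. y (i + k) = z (j + k)) \<longrightarrow> F y i = F z j"
proof -
  obtain a b f where
    F: "\<And>x i. x \<in> configs n \<Longrightarrow> F x i = f (map x [i - int a..i + int b])"
    using assms unfolding cellular_automaton_def by blast
  have "F y i = F z j"
    if "y \<in> configs n" "z \<in> configs n" and eq: "\<forall>k\<in>{- int a..int b}. y (i + k) = z (j + k)"
    for y z i j
  proof -
    have "map y [i - int a..i + int b] = map z [j - int a..j + int b]"
    proof (rule nth_equalityI)
      fix k assume "k < length (map y [i - int a..i + int b])"
      then have k: "k < a + b + 1" by simp
      then have "int k - int a \<in> {- int a..int b}" by auto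
      from eq[rule_format, OF this] k
      show "map y [i - int a..i + int b] ! k = map z [j - int a..j + int b] ! k"
        by (simp add: algebra_simps)
    qed simp
    then show ?thesis using F that by simp
  qed
  then show ?thesis by blast
qed

lemma cellular_automaton_configs:
  assumes "cellular_automaton n F" "y \<in> configs n"
  shows "F y \<in> configs n"
proof -
  obtain a b f where
    f: "\<And>u. length u = a + b + 1 \<Longrightarrow> set u \<subseteq> {..<n} \<Longrightarrow> f u < n" and
    F: "\<And>x i. x \<in> configs n \<Longrightarrow> F x i = f (map x [i - int a..i + int b])"
    using assms(1) unfolding cellular_automaton_def by blast
  have "F y i < n" for i
  proof -
    have "f (map y [i - int a..i + int b]) < n"
      using assms(2) by (intro f) (auto simp: configs_def)
    then show ?thesis using F[OF assms(2)] by simp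
  qed
  then show ?thesis by (simp add: configs_def)
qed

lemma orbit_configs:
  assumes "cellular_automaton n F" "y \<in> configs n"
  shows "(F ^^ t) y \<in> configs n"
  using assms by (induction t) (auto intro: cellular_automaton_configs)

lemma left_edge_number_like:
  assumes "y \<in> number_like n"
  shows "y (left_edge y) \<noteq> 0" "\<And>i. i < left_edge y \<Longrightarrow> y i = 0"
proof -
  obtain N where N: "\<And>i. i < N \<Longrightarrow> y i = 0" and "y \<noteq> zero_config"
    using assms unfolding number_like_def by blast
  then obtain m where m: "y m \<noteq> 0" by (auto simp: zero_config_def fun_eq_iff)
  define k where "k = (LEAST k. y (N + int k) \<noteq> 0)"
  have "y (N + int (nat (m - N))) \<noteq> 0" using m N[of m] by (cases "m < N") auto
  then have k: "y (N + int k) \<noteq> 0" unfolding k_def by (rule LeastI)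
  have below: "y i = 0" if "i < N + int k" for i
  proof (cases "i < N")
    case False
    then have "nat (i - N) < k" using that by simp
    then have "y (N + int (nat (i - N))) = 0" unfolding k_def using not_less_Least by blast
    then show ?thesis using False by simp
  qed (use N in simp)
  have "left_edge y = N + int k"
    unfolding left_edge_def using k below by (intro Least_equality) (auto intro: leI)
  with k below show "y (left_edge y) \<noteq> 0" "\<And>i. i < left_edge y \<Longrightarrow> y i = 0" by auto
qed

text \<open>An orbit that reaches \<open>zero_config\<close> would stay there, but spreading provides nonzero iterates
  at arbitrarily late times.\<close>

lemma orbit_number_like:
  assumes n: "n \<ge> 1" and ca: "cellular_automaton n F" and sp: "left_spreading n F"
    and x: "x \<in> number_like n"
  shows "(F ^^ t) x \<in> number_like n"
proof -
  have F0: "F zero_config = zero_config" using sp by (simp add: left_spreading_def)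
  have zc: "zero_config \<in> configs n" using n by (auto simp: configs_def zero_config_def)
  have xc: "x \<in> configs n" using x by (simp add: number_like_def)
  obtain a b where loc: "\<And>y z i j. y \<in> configs n \<Longrightarrow> z \<in> configs n \<Longrightarrow>
      \<forall>k\<in>{- int a..int b}. y (i + k) = z (j + k) \<Longrightarrow> F y i = F z j"
    using cellular_automaton_local[OF ca] by blast
  have left_zero: "\<exists>N. \<forall>i<N. (F ^^ t) x i = 0"
  proof (induction t)
    case 0
    then show ?case using x by (simp add: number_like_def)
  next
    case (Suc t)
    then obtain N where N: "\<And>i. i < N \<Longrightarrow> (F ^^ t) x i = 0" by blast
    have "F ((F ^^ t) x) i = F zero_config i" if "i < N - int b" for i
      using that N by (intro loc orbit_configs[OF ca xc] zc) (auto simp: zero_config_def)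
    then show ?case using F0 by (intro exI[of _ "N - int b"]) (simp add: zero_config_def)
  qed
  have late: "\<exists>u\<ge>k. (F ^^ u) x \<in> number_like n" for k
  proof (induction k)
    case 0
    then show ?case using x by (intro exI[of _ 0]) simp
  next
    case (Suc k)
    then obtain u where u: "u \<ge> k" "(F ^^ u) x \<in> number_like n" by blast
    then obtain v where "v \<ge> 1" "(F ^^ v) ((F ^^ u) x) \<in> number_like n"
      using sp unfolding left_spreading_def by blast
    then show ?case using u by (intro exI[of _ "v + u"]) (simp add: funpow_add)
  qed
  have "(F ^^ t) x \<noteq> zero_config"
  proof
    assume z: "(F ^^ t) x = zero_config"
    obtain u where u: "u \<ge> t" "(F ^^ u) x \<in> number_like n" using late by blast
    have "(F ^^ k) zero_config = zero_config" for k using F0 by (induction k) auto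
    then have "(F ^^ (u - t)) ((F ^^ t) x) = zero_config" using z by simp
    then have "(F ^^ u) x = zero_config"
      using u(1) by (metis comp_apply funpow_add le_add_diff_inverse2)
    then show False using u(2) by (simp add: number_like_def)
  qed
  then show ?thesis using left_zero orbit_configs[OF ca xc] by (simp add: number_like_def)
qed

text \<open>Left expansivity in forward time: the rows of the window run from \<open>h\<close> steps before the time
  in question to \<open>d\<close> steps after it.\<close>

lemma left_expansive_orbits:
  assumes le: "left_expansive n F h d w" and y: "y \<in> configs n" and z: "z \<in> configs n"
    and t: "t \<ge> h" and u: "u \<ge> h"
    and eq: "\<And>c s. c < w \<Longrightarrow> s \<le> h + d \<Longrightarrow>
      (F ^^ (t - h + s)) y (i + int c) = (F ^^ (u - h + s)) z (j + int c)"
  shows "(F ^^ t) y (i - 1) = (F ^^ u) z (j - 1)"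
proof -
  have sub: "(+) (k, - int v) ` rect h d w \<subseteq> UNIV \<times> {..0}" if "v \<ge> h" for k v
    using that by (auto simp: rect_def)
  have win: "\<forall>\<rho>\<in>rect h d w. space_time F y ((i, - int t) + \<rho>) = space_time F z ((j, - int u) + \<rho>)"
  proof
    fix \<rho> assume "\<rho> \<in> rect h d w"
    then obtain c e where \<rho>: "\<rho> = (c, e)" "0 \<le> c" "c < int w" "- int d \<le> e" "e \<le> int h"
      by (auto simp: rect_def)
    define s where "s = nat (int h - e)"
    have s: "nat (- (- int t + e)) = t - h + s" "nat (- (- int u + e)) = u - h + s" "s \<le> h + d"
      using \<rho> t u by (auto simp: s_def)
    have "(F ^^ (t - h + s)) y (i + int (nat c)) = (F ^^ (u - h + s)) z (j + int (nat c))"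
      using \<rho> s by (intro eq) auto
    then show "space_time F y ((i, - int t) + \<rho>) = space_time F z ((j, - int u) + \<rho>)"
      unfolding space_time_def \<rho>(1) using \<rho>(2) by (simp only: add_Pair prod.case s) simp
  qed
  have "space_time F y (i - 1, - int t) = space_time F z (j - 1, - int u)"
    using le[unfolded left_expansive_def space_time_diagrams_def] sub t u win y z by blast
  then show ?thesis by (simp add: space_time_def)
qed

section \<open>Recurrence forces spatial periodicity on the right\<close>

text \<open>Agreement on a half-line, up to a translation by \<open>q\<close>, is lost at most at the speed of the left
  radius \<open>a\<close> of the automaton.\<close>

lemma agreement_on_right_propagates:
  assumes ca: "cellular_automaton n F"
  obtains a :: nat where "\<And>y z q i j. y \<in> configs n \<Longrightarrow> z \<in> configs n \<Longrightarrow>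
    (\<forall>j\<ge>i. y j = z (j + q)) \<Longrightarrow> j \<ge> i + int a \<Longrightarrow> F y j = F z (j + q)"
proof -
  obtain a b where loc: "\<forall>y\<in>configs n. \<forall>z\<in>configs n. \<forall>i j.
      (\<forall>k\<in>{- int a..int b}. y (i + k) = z (j + k)) \<longrightarrow> F y i = F z j"
    using cellular_automaton_local[OF ca] by blast
  have "F y j = F z (j + q)"
    if "y \<in> configs n" "z \<in> configs n" "\<forall>j\<ge>i. y j = z (j + q)" "j \<ge> i + int a" for y z q i j
  proof -
    have "\<forall>k\<in>{- int a..int b}. y (j + k) = z (j + q + k)"
    proof
      fix k assume "k \<in> {- int a..int b}"
      then have "j + k \<ge> i" using that(4) by auto
      then have "y (j + k) = z (j + k + q)" using that(3) by blast
      then show "y (j + k) = z (j + q + k)" by (simp add: algebra_simps)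
    qed
    then show ?thesis using loc that(1,2) by blast
  qed
  then show ?thesis using that by blast
qed

text \<open>The state at position \<open>i\<close> consists of \<open>p\<close> rows of the \<open>w\<close> columns starting at \<open>i\<close>. Far enough to
  the right these rows repeat with period \<open>p\<close> for longer than the height of the window of
  expansivity, so they determine the window at any height and with it the state at \<open>i - 1\<close>.\<close>

lemma recurrence_imp_right_periodic:
  assumes ca: "cellular_automaton n F" and le: "left_expansive n F h d w" and w: "w \<ge> 1"
    and x: "x \<in> configs n" and p: "p > 0" and rec: "frac_part ((F ^^ p) x) = frac_part x"
  shows "\<exists>I\<ge>0. \<exists>q>0. \<forall>j\<ge>I. x j = x (j + int q)"
proof -
  obtain a :: nat where spread: "\<And>y z q i j. y \<in> configs n \<Longrightarrow> z \<in> configs n \<Longrightarrow>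
      (\<forall>j\<ge>i. y j = z (j + q)) \<Longrightarrow> j \<ge> i + int a \<Longrightarrow> F y j = F z (j + q)"
    using agreement_on_right_propagates[OF ca] by blast
  define y where "y t = (F ^^ t) x" for t
  have yc: "y t \<in> configs n" for t unfolding y_def by (rule orbit_configs[OF ca x])
  have per: "\<forall>j\<ge>int (a * k). y k j = y (k + p) j" for k
  proof (induction k)
    case 0
    show ?case
    proof (intro allI impI)
      fix j assume "j \<ge> int (a * 0)"
      then have "j = int (nat j)" by simp
      then show "y 0 j = y (0 + p) j"
        using rec unfolding y_def frac_part_def by (metis add_0 funpow_0)
    qed
  next
    case (Suc k)
    show ?case
    proof (intro allI impI)
      fix j assume "j \<ge> int (a * Suc k)"
      then have "j \<ge> int (a * k) + int a" by (simp add: algebra_simps)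
      then have "F (y k) j = F (y (k + p)) (j + 0)" using Suc by (intro spread yc) auto
      then show "y (Suc k) j = y (Suc k + p) j" by (simp add: y_def)
    qed
  qed
  define K where "K = p + p * h + d"
  have mod_p: "y u j = y (u mod p) j" if "u \<le> K" "j \<ge> int (a * K)" for u j
    using that(1)
  proof (induction u rule: less_induct)
    case (less u)
    show ?case
    proof (cases "u < p")
      case False
      have "a * (u - p) \<le> a * K" using less.prems by (intro mult_le_mono2) simp
      then have "j \<ge> int (a * (u - p))" using that(2) by linarith
      then have "y (u - p) j = y u j" using per[of "u - p"] False by simp
      moreover have "y (u - p) j = y ((u - p) mod p) j" using less False p by simp
      ultimately show ?thesis using False by (simp add: le_mod_geq)
    qed simp
  qed
  define I where "I = int (a * K)"
  define s where "s k = restrict (\<lambda>(c, \<tau>). y \<tau> (I + int k + int c)) ({..<w} \<times> {..<p})" for k :: nat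
  have s_eq: "s i = s j \<longleftrightarrow> (\<forall>c<w. \<forall>\<tau><p. y \<tau> (I + int i + int c) = y \<tau> (I + int j + int c))" for i j
    unfolding s_def by (auto simp: fun_eq_iff restrict_def split: if_splits)
  have "finite (range s)"
  proof (rule finite_subset)
    show "range s \<subseteq> ({..<w} \<times> {..<p}) \<rightarrow>\<^sub>E {..<n}"
      using yc unfolding s_def configs_def by (intro image_subsetI restrict_PiE) auto
  qed (intro finite_PiE; simp)
  moreover have "s i = s j" if "s (Suc i) = s (Suc j)" for i j
    unfolding s_eq
  proof (intro allI impI)
    fix c \<tau> assume c: "c < w" and \<tau>: "\<tau> < p"
    from that have nxt:
      "y \<tau> (I + int (Suc i) + int c) = y \<tau> (I + int (Suc j) + int c)" if "c < w" "\<tau> < p" for c \<tau>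
      using that unfolding s_eq by blast
    show "y \<tau> (I + int i + int c) = y \<tau> (I + int j + int c)"
    proof (cases c)
      case (Suc c')
      then show ?thesis using nxt[of c' \<tau>] c \<tau> by (simp add: algebra_simps)
    next
      case 0
      \<comment> \<open>Row \<open>\<tau>\<close> may lack the \<open>h\<close> rows above it that the window needs, so an equal row, a multiple
        of the period later, takes its place.\<close>
      define t where "t = \<tau> + p * h"
      have "h \<le> p * h" using p by (cases p) auto
      then have ht: "h \<le> t" unfolding t_def by linarith
      have tK: "t \<le> K" using \<tau> by (simp add: t_def K_def)
      have "(F ^^ t) x (I + int (Suc i) - 1) = (F ^^ t) x (I + int (Suc j) - 1)"
      proof (rule left_expansive_orbits[OF le x x ht ht])
        fix c s assume c: "c < w" and s: "s \<le> h + d"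
        have u: "t - h + s \<le> K" using s ht \<tau> by (simp add: t_def K_def)
        have "y (t - h + s) (I + int (Suc i) + int c)
            = y ((t - h + s) mod p) (I + int (Suc i) + int c)"
          by (rule mod_p[OF u]) (simp add: I_def)
        also have "\<dots> = y ((t - h + s) mod p) (I + int (Suc j) + int c)"
          using nxt c p by simp
        also have "\<dots> = y (t - h + s) (I + int (Suc j) + int c)"
          by (rule mod_p[OF u, symmetric]) (simp add: I_def)
        finally show "(F ^^ (t - h + s)) x (I + int (Suc i) + int c)
            = (F ^^ (t - h + s)) x (I + int (Suc j) + int c)" by (simp add: y_def)
      qed
      then have "y t (I + int i) = y t (I + int j)" by (simp add: y_def)
      moreover have "y t (I + int k) = y \<tau> (I + int k)" for k
        using mod_p[OF tK, of "I + int k"] \<tau> by (simp add: I_def t_def)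
      ultimately show ?thesis using 0 by simp
    qed
  qed
  ultimately obtain q where q: "q > 0" "\<And>i. s (i + q) = s i"
    using backward_deterministic_imp_periodic by blast
  have "x j = x (j + int q)" if "j \<ge> I" for j
  proof -
    have "s (nat (j - I)) = s (nat (j - I) + q)" using q by simp
    then have "y 0 (I + int (nat (j - I)) + int 0) = y 0 (I + int (nat (j - I) + q) + int 0)"
      unfolding s_eq using w p by (metis less_eq_Suc_le One_nat_def)
    then show ?thesis using that by (simp add: y_def)
  qed
  moreover have "I \<ge> 0" by (simp add: I_def)
  ultimately show ?thesis using q(1) by blast
qed

section \<open>Finiteness of the recurrence times\<close>

lemma left_edge_eventually_above:
  assumes "x \<in> number_like n" and "spreading_speed n F < ereal \<sigma>"
  shows "\<forall>\<^sub>F t in sequentially. real_of_int (left_edge ((F ^^ t) x)) > - \<sigma> * real t"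
proof -
  have "limsup (\<lambda>t. ereal (- real_of_int (left_edge ((F ^^ t) x)) / real t)) \<le> spreading_speed n F"
    unfolding spreading_speed_def using assms(1) by (rule SUP_upper)
  then have "limsup (\<lambda>t. ereal (- real_of_int (left_edge ((F ^^ t) x)) / real t)) < ereal \<sigma>"
    using assms(2) by simp
  then have "\<forall>\<^sub>F t in sequentially. ereal (- real_of_int (left_edge ((F ^^ t) x)) / real t) < ereal \<sigma>"
    by (rule Limsup_lessD)
  then show ?thesis
    using eventually_gt_at_top[of 0]
  proof eventually_elim
    case (elim t)
    then have "- real_of_int (left_edge ((F ^^ t) x)) / real t < \<sigma>" "0 < real t" by auto
    then have "- real_of_int (left_edge ((F ^^ t) x)) < \<sigma> * real t"
      using pos_divide_less_eq by blast
    then show ?case by simp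
  qed
qed

lemma number_like_not_periodic_left_of_edge:
  assumes y: "y \<in> number_like n" and q: "q > 0" and per: "\<forall>j\<ge>i. y j = y (j + int q)"
  shows "i > left_edge y - int q"
proof (rule ccontr)
  assume "\<not> i > left_edge y - int q"
  then have "y (left_edge y - int q) = y (left_edge y)"
    using spec[OF per, of "left_edge y - int q"] by simp
  then show False using left_edge_number_like[OF y] q by auto
qed

theorem theorem4p5:
  fixes n :: nat and F :: "(int \<Rightarrow> nat) \<Rightarrow> (int \<Rightarrow> nat)" and x :: "int \<Rightarrow> nat"
  assumes "n \<ge> 1"
    and "cellular_automaton n F"
    and "rapidly_left_expansive n F"
    and "x \<in> number_like n"
  shows "finite {t :: nat. frac_part ((F ^^ t) x) = frac_part x}"
proof (rule ccontr)
  assume inf: "infinite {t :: nat. frac_part ((F ^^ t) x) = frac_part x}"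
  note ca = assms(2)
  obtain h d w where w: "w \<ge> 1" and le: "left_expansive n F h d w" and sp: "left_spreading n F"
    and speed: "spreading_speed n F < (if h = 0 then \<infinity> else ereal (1 / real h))"
    using assms(3) unfolding rapidly_left_expansive_def by blast
  have x: "x \<in> configs n" using assms(4) by (simp add: number_like_def)
  define y where "y t = (F ^^ t) x" for t
  have yc: "y t \<in> configs n" for t unfolding y_def by (rule orbit_configs[OF ca x])
  have yn: "y t \<in> number_like n" for t
    unfolding y_def using orbit_number_like assms sp by blast
  obtain p where "p > 0" "frac_part ((F ^^ p) x) = frac_part x"
    using inf by (auto simp: infinite_nat_iff_unbounded)
  from recurrence_imp_right_periodic[OF ca le w x this]
  obtain I q where I: "I \<ge> 0" and q: "q > 0" and xq: "\<And>j. j \<ge> I \<Longrightarrow> x j = x (j + int q)"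
    by blast
  obtain a :: nat where spread: "\<And>y z q i j. y \<in> configs n \<Longrightarrow> z \<in> configs n \<Longrightarrow>
      (\<forall>j\<ge>i. y j = z (j + q)) \<Longrightarrow> j \<ge> i + int a \<Longrightarrow> F y j = F z (j + q)"
    using agreement_on_right_propagates[OF ca] by blast

  define P where "P t i \<longleftrightarrow> (\<forall>j\<ge>i. y t j = y t (j + int q))" for t i
  have P_Suc: "P (Suc t) (i + int a)" if "P t i" for t i
    unfolding P_def
  proof (intro allI impI)
    fix j assume "j \<ge> i + int a"
    then have "F (y t) j = F (y t) (j + int q)"
      using that unfolding P_def by (rule spread[OF yc yc, rotated])
    then show "y (Suc t) j = y (Suc t) (j + int q)" by (simp add: y_def)
  qed
  have P_above_edge: "i > left_edge (y t) - int q" if "P t i" for t i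
    using number_like_not_periodic_left_of_edge[OF yn q] that unfolding P_def by blast
  have P_left: "P t (i - 1)" if t: "t \<ge> h" and P: "\<And>\<tau>. \<tau> \<in> {t - h..t + d} \<Longrightarrow> P \<tau> i" for t i
  proof -
    have "(F ^^ t) x (i - 1) = (F ^^ t) x (i + int q - 1)"
    proof (rule left_expansive_orbits[OF le x x t t])
      fix c s assume "s \<le> h + d"
      then have "P (t - h + s) i" using t by (intro P) auto
      then have "y (t - h + s) (i + int c) = y (t - h + s) (i + int c + int q)"
        unfolding P_def by (metis le_add_same_cancel1 of_nat_0_le_iff)
      then show "(F ^^ (t - h + s)) x (i + int c) = (F ^^ (t - h + s)) x (i + int q + int c)"
        by (simp add: y_def algebra_simps)
    qed
    then have "y t (i - 1) = y t (i - 1 + int q)" by (simp add: y_def algebra_simps)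
    moreover have "P t i" using t by (intro P) auto
    moreover have "j = i - 1 \<or> j \<ge> i" if "j \<ge> i - 1" for j using that by linarith
    ultimately show ?thesis unfolding P_def by blast
  qed
  have P_ex: "\<exists>i. P t i" for t
  proof (induction t)
    case 0
    have "\<forall>j\<ge>I. x j = x (j + int q)" using xq by blast
    then have "P 0 I" by (simp only: P_def y_def funpow_0)
    then show ?case ..
  qed (use P_Suc in blast)

  have "\<exists>i. \<forall>j. P t j \<longleftrightarrow> i \<le> j" for t
  proof -
    obtain i0 where i0: "P t i0" using P_ex by blast
    define e where "e = left_edge (y t) - int q"
    define k where "k = (LEAST k. P t (e + int k))"
    have "P t (e + int (nat (i0 - e)))" using i0 P_above_edge[OF i0] by (simp add: e_def)
    then have k: "P t (e + int k)" unfolding k_def by (rule LeastI)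
    have "e + int k \<le> j" if j: "P t j" for j
    proof -
      have "e < j" using P_above_edge[OF j] by (simp add: e_def)
      then have "P t (e + int (nat (j - e)))" using j by simp
      then have "k \<le> nat (j - e)" unfolding k_def by (rule Least_le)
      then show ?thesis using \<open>e < j\<close> by linarith
    qed
    moreover have "P t j" if "e + int k \<le> j" for j
      using k that unfolding P_def by (meson order_trans)
    ultimately show ?thesis by blast
  qed
  then obtain b where b: "\<And>t j. P t j \<longleftrightarrow> b t \<le> j" by metis

  have "\<exists>B. \<forall>m t. h * m \<le> t \<longrightarrow> b t \<le> B - int m"
  proof (rule recurrent_boundary_drifts_left)
    show "b (Suc t) \<le> b t + int a" for t using P_Suc[of t "b t"] b by simp
    show "\<exists>\<tau>\<in>{t - h..t + d}. b t < b \<tau>" if "t \<ge> h" for t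
    proof (rule ccontr)
      assume "\<not> ?thesis"
      then have "P t (b t - 1)" using that b by (intro P_left) (auto simp: not_less)
      then show False using b by simp
    qed
    have "b t \<le> I" if "frac_part ((F ^^ t) x) = frac_part x" for t
    proof -
      have same: "y t j = x j" if "j \<ge> 0" for j
        using fun_cong[OF \<open>frac_part ((F ^^ t) x) = frac_part x\<close>, of "nat j"] that
        by (simp add: frac_part_def y_def)
      have "y t j = y t (j + int q)" if "j \<ge> I" for j
      proof -
        have "0 \<le> j" "0 \<le> j + int q" using that I by auto
        then show ?thesis using same xq[OF that] by metis
      qed
      then have "P t I" unfolding P_def by blast
      then show ?thesis using b by simp
    qed
    then show "infinite {t. b t \<le> I}" using inf infinite_super by (metis (mono_tags) Collect_mono)
  qed
  then obtain B where B: "\<And>m t. h * m \<le> t \<Longrightarrow> b t \<le> B - int m" by blast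
  have edge: "left_edge (y t) - int q < B - int m" if "h * m \<le> t" for m t
    using B[OF that] b P_above_edge by blast
  show False
  proof (cases "h = 0")
    case True
    then show ?thesis using edge[of "nat (B - left_edge (y 0) + int q)" 0] by (simp split: if_splits)
  next
    case False
    then have "spreading_speed n F < ereal (1 / real h)" using speed by (simp only: if_False)
    then obtain \<sigma> where \<sigma>: "spreading_speed n F < ereal \<sigma>" "\<sigma> < 1 / real h"
      using ereal_dense2 less_ereal.simps(1) by blast
    have h\<sigma>: "1 - \<sigma> * real h > 0" using \<sigma>(2) False by (simp add: field_simps)
    from left_edge_eventually_above[OF assms(4) \<sigma>(1)]
    obtain t0 where t0: "\<And>t. t \<ge> t0 \<Longrightarrow> real_of_int (left_edge (y t)) > - \<sigma> * real t"
      unfolding y_def eventually_sequentially by blast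
    \<comment> \<open>At time \<open>h * m\<close> the two bounds leave only \<open>(1 - \<sigma> * h) * m < B + q\<close>.\<close>
    obtain m1 :: nat where m1: "real m1 * (1 - \<sigma> * real h) > real_of_int B + real q"
      using reals_Archimedean3[OF h\<sigma>] by blast
    define m where "m = max m1 t0"
    have "h * m \<ge> t0" using False by (cases h) (auto simp: m_def)
    then have "real_of_int (left_edge (y (h * m))) > - \<sigma> * real (h * m)" by (rule t0)
    moreover have "left_edge (y (h * m)) < B - int m + int q" using edge[of m "h * m"] by simp
    then have "real_of_int (left_edge (y (h * m))) < real_of_int B - real m + real q"
      by linarith
    ultimately have "real m * (1 - \<sigma> * real h) < real_of_int B + real q"
      by (simp add: algebra_simps)
    moreover have "real m1 * (1 - \<sigma> * real h) \<le> real m * (1 - \<sigma> * real h)"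
      using h\<sigma> by (intro mult_right_mono) (auto simp: m_def)
    ultimately show False using m1 by linarith
  qed
qed

end
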